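(* Let $I\subset\mathbb{R}$ be an interval, let $a,b\in I$ with $a<b$, and let $f:I\to\mathbb{R}$ be twice differentiable on the interior $I^{\circ}$ of $I$, with $f''\in L_1[a,b]$. Let $q\ge 1$. If $|f''|^q$ is quasi-convex on $[a,b]$, then $$\left|\frac{1}{b-a}\int_a^b f(x)\,dx-f\left(\frac{a+b}{2}\right)\right|\le \frac{(b-a)^2}{24}\left(\sup\left\{|f''(a)|^q,|f''(b)|^q\right\}\right)^{1/q}.$$
   Context: A function $g:[a,b]\to\mathbb{R}$ is quasi-convex on $[a,b]$ if $g(tx+(1-t)y)\le\sup\{g(x),g(y)\}$ for all $x,y\in[a,b]$ and $t\in[0,1]$. The hypotheses on $f''$ over $[a,b]$ presuppose that $f$ is twice differentiable at every point of $[a,b]$; if $a$ or $b$ is an endpoint of $I$, the derivatives $f'$ and $f''$ there are understood as one-sided derivatives. *)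

theory Defs
  imports "HOL-Analysis.Analysis"
begin

definition quasi_convex_on :: "real set \<Rightarrow> (real \<Rightarrow> real) \<Rightarrow> bool" where
  "quasi_convex_on S g \<longleftrightarrow>
     (\<forall>x\<in>S. \<forall>y\<in>S. \<forall>t\<in>{0..1}. g (t * x + (1 - t) * y) \<le> Sup {g x, g y})"

(* Differentiability is taken relative to the interval I: at interior points
   of I this is the usual derivative, and at an endpoint of I it is the
   one-sided derivative. *)
definition twice_derivs_on ::
    "real set \<Rightarrow> real set \<Rightarrow> (real \<Rightarrow> real) \<Rightarrow> (real \<Rightarrow> real) \<Rightarrow> (real \<Rightarrow> real) \<Rightarrow> bool" where
  "twice_derivs_on I S f f' f'' \<longleftrightarrow>
     (\<forall>x\<in>S. (f has_real_derivative f' x) (at x within I) \<and>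
            (f' has_real_derivative f'' x) (at x within I))"

end

(* If M bounds |f''| on [a, b], then M/2 x^2 + f x and M/2 x^2 - f x are both convex, so at
   the midpoint c each lies below its mean value. Since the mean of x^2 exceeds c^2 by
   (b - a)^2 / 12, the two inequalities together give the bound M (b - a)^2 / 24.
   Quasi-convexity of |f''|^q provides M = (sup {|f''(a)|^q, |f''(b)|^q})^(1/q). *)
theory Submission
  imports Defs
begin

lemma has_integral_reflect_midpoint:
  fixes h :: "real \<Rightarrow> real"
  assumes "(h has_integral J) {a..b}" "a \<le> b"
  shows "((\<lambda>x. h (a + b - x)) has_integral J) {a..b}"
proof -
  \<comment> \<open>Affine substitution with slope -1: the scaling factor is 1, and the inverse map
    carries the interval onto itself.\<close>
  have "((\<lambda>x. h ((- 1) *\<^sub>R x + (a + b))) has_integral (1 / \<bar>- 1\<bar> ^ DIM(real)) *\<^sub>R J)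
      ((\<lambda>x. (1 / (- 1)) *\<^sub>R x + - ((1 / (- 1)) *\<^sub>R (a + b))) ` cbox a b)"
    by (rule has_integral_affinity) (use assms in auto)
  moreover have "(\<lambda>x. (a + b) - x) ` {a..b} = {a..b}"
    by (simp add: image_diff_atLeastAtMost)
  ultimately show ?thesis
    by (simp add: algebra_simps)
qed

text \<open>Left half of the Hermite-Hadamard inequality. Averaging \<open>h\<close> with its
  reflection about the midpoint keeps the integral, and by convexity this average is nowhere below
  the midpoint value. Convexity is asked on the open interval, where two-sided second derivatives
  can establish it.\<close>

lemma convex_on_midpoint_le_integral:
  fixes h :: "real \<Rightarrow> real"
  assumes conv: "convex_on {a<..<b} h" and int: "h integrable_on {a..b}" and "a \<le> b"
  shows "(b - a) * h ((a + b) / 2) \<le> integral {a..b} h"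
proof -
  have h: "(h has_integral integral {a..b} h) {a..b}"
    using int by blast
  have "((\<lambda>x. (h x + h (a + b - x)) / 2) has_integral
      (integral {a..b} h + integral {a..b} h) / 2) {a..b}"
    by (intro has_integral_divide has_integral_add h has_integral_reflect_midpoint \<open>a \<le> b\<close>)
  \<comment> \<open>The endpoints form a null set, so the comparison can be made on the open
    interval, where \<open>conv\<close> applies.\<close>
  then have mean: "((\<lambda>x. (h x + h (a + b - x)) / 2) has_integral integral {a..b} h) {a<..<b}"
    by (simp add: has_integral_Icc_iff_Ioo)
  have "((\<lambda>x. h ((a + b) / 2)) has_integral (b - a) * h ((a + b) / 2)) {a<..<b}"
    using has_integral_const_real[of "h ((a + b) / 2)" a b] \<open>a \<le> b\<close>
    by (simp add: has_integral_Icc_iff_Ioo)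
  moreover note mean
  moreover have "h ((a + b) / 2) \<le> (h x + h (a + b - x)) / 2" if "x \<in> {a<..<b}" for x
    using convex_onD[OF conv, of "1/2" x "a + b - x"] that by (simp add: field_simps)
  ultimately show ?thesis
    by (rule has_integral_le)
qed

text \<open>One half of the final estimate, phrased with a lower bound on \<open>g''\<close> so that
  it serves both \<open>f\<close> and \<open>- f\<close>.\<close>

lemma midpoint_le_integral_mean:
  fixes g g' g'' :: "real \<Rightarrow> real"
  assumes ab: "a < b"
    and g: "\<And>x. x \<in> {a<..<b} \<Longrightarrow> (g has_real_derivative g' x) (at x)"
    and g': "\<And>x. x \<in> {a<..<b} \<Longrightarrow> (g' has_real_derivative g'' x) (at x)"
    and lower: "\<And>x. x \<in> {a<..<b} \<Longrightarrow> - M \<le> g'' x"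
    and int: "g integrable_on {a..b}"
  shows "g ((a + b) / 2) - 1 / (b - a) * integral {a..b} g \<le> (b - a)\<^sup>2 / 24 * M"
proof -
  let ?h = "\<lambda>x. M / 2 * x\<^sup>2 + g x"
  have conv: "convex_on {a<..<b} ?h"
  proof (rule f''_ge0_imp_convex)
    show "(?h has_real_derivative M * x + g' x) (at x)" if "x \<in> {a<..<b}" for x
      by (auto intro!: derivative_eq_intros g that)
    show "((\<lambda>x. M * x + g' x) has_real_derivative M + g'' x) (at x)" if "x \<in> {a<..<b}" for x
      by (auto intro!: derivative_eq_intros g' that)
  qed (use lower in force)+
  have "((\<lambda>x. M / 2 * x\<^sup>2) has_integral M / 6 * b ^ 3 - M / 6 * a ^ 3) {a..b}"
    using ab
    by (intro fundamental_theorem_of_calculus)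
      (auto intro!: derivative_eq_intros simp flip: has_real_derivative_iff_has_vector_derivative)
  then have h: "(?h has_integral M / 6 * b ^ 3 - M / 6 * a ^ 3 + integral {a..b} g) {a..b}"
    using int by (intro has_integral_add) auto
  have "(b - a) * ?h ((a + b) / 2) \<le> M / 6 * b ^ 3 - M / 6 * a ^ 3 + integral {a..b} g"
    using convex_on_midpoint_le_integral[OF conv has_integral_integrable[OF h]] h ab
    by (simp add: integral_unique)
  \<comment> \<open>The integral of the quadratic term is split into its midpoint part, which
    cancels, and the excess that becomes the error bound.\<close>
  moreover have "M / 6 * b ^ 3 - M / 6 * a ^ 3
      = (b - a) * (M / 2 * ((a + b) / 2)\<^sup>2 + (b - a)\<^sup>2 / 24 * M)"
    by (simp add: field_simps power2_eq_square power3_eq_cube)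
  ultimately have "(b - a) * g ((a + b) / 2) \<le> (b - a) * ((b - a)\<^sup>2 / 24 * M) + integral {a..b} g"
    by (simp only: distrib_left)
  then show ?thesis
    using ab by (simp add: field_simps)
qed

lemma quasi_convex_on_Icc_le_Sup_endpoints:
  assumes "quasi_convex_on {a..b} g" "x \<in> {a..b}" "a < b"
  shows "g x \<le> Sup {g a, g b}"
proof -
  \<comment> \<open>The weight of \<open>a\<close> when \<open>x\<close> is written as a convex
    combination of the endpoints.\<close>
  define t where "t = (b - x) / (b - a)"
  have "t * (b - a) = b - x"
    using assms by (simp add: t_def)
  then have "t * a + (1 - t) * b = x"
    by (simp add: algebra_simps)
  moreover have "t \<in> {0..1}"
    using assms by (simp add: t_def)
  then have "g (t * a + (1 - t) * b) \<le> Sup {g a, g b}"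
    using assms unfolding quasi_convex_on_def by auto
  ultimately show ?thesis
    by simp
qed

theorem theorem8:
  fixes I :: "real set" and a b q :: real and f f' f'' :: "real \<Rightarrow> real"
  assumes "is_interval I" and "a \<in> I" and "b \<in> I" and "a < b"
    and "twice_derivs_on I (interior I \<union> {a..b}) f f' f''"
    and "f'' absolutely_integrable_on {a..b}"
    and "q \<ge> 1"
    and "quasi_convex_on {a..b} (\<lambda>x. \<bar>f'' x\<bar> powr q)"
  shows "\<bar>1 / (b - a) * integral {a..b} f - f ((a + b) / 2)\<bar>
      \<le> (b - a)\<^sup>2 / 24 * (Sup {\<bar>f'' a\<bar> powr q, \<bar>f'' b\<bar> powr q}) powr (1 / q)"
proof -
  define M where "M = (Sup {\<bar>f'' a\<bar> powr q, \<bar>f'' b\<bar> powr q}) powr (1 / q)"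
  have M: "\<bar>f'' x\<bar> \<le> M" if "x \<in> {a<..<b}" for x
  proof -
    \<comment> \<open>Quasi-convexity controls the \<open>q\<close>-th power; the
      \<open>q\<close>-th root is monotone on nonnegative reals and carries the bound over to
      \<open>f''\<close>. Zeros of \<open>f''\<close> cause no trouble, since
      \<open>0 powr q\<close> is 0.\<close>
    have "\<bar>f'' x\<bar> = (\<bar>f'' x\<bar> powr q) powr (1 / q)"
      using \<open>q \<ge> 1\<close> by (simp add: powr_powr)
    also have "\<dots> \<le> M"
      unfolding M_def using \<open>q \<ge> 1\<close> that
      by (intro powr_mono2 quasi_convex_on_Icc_le_Sup_endpoints[OF assms(8) _ \<open>a < b\<close>]) auto
    finally show ?thesis .
  qed
  have sub: "{a..b} \<subseteq> I"
    by (intro subsetI mem_is_interval_1_I[OF assms(1-3)]) simp_all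
  \<comment> \<open>Derivatives within \<open>{a..b}\<close> serve two purposes: up to the endpoints
    they make \<open>f\<close> continuous and hence integrable, and at inner points they are
    two-sided.\<close>
  have within: "(f has_real_derivative f' x) (at x within {a..b})"
      "(f' has_real_derivative f'' x) (at x within {a..b})" if "x \<in> {a..b}" for x
    using assms(5) that unfolding twice_derivs_on_def by (blast intro: DERIV_subset[OF _ sub])+
  have inner: "at x within {a..b} = at x" if "x \<in> {a<..<b}" for x
    using that by (simp add: at_within_Icc_at)
  have f: "(f has_real_derivative f' x) (at x)"
      and f': "(f' has_real_derivative f'' x) (at x)" if "x \<in> {a<..<b}" for x
    using within[of x] that unfolding inner[OF that] by simp_all
  have int: "f integrable_on {a..b}"
    by (rule integrable_continuous_real, rule DERIV_continuous_on, rule within(1))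
  have "f ((a + b) / 2) - 1 / (b - a) * integral {a..b} f \<le> (b - a)\<^sup>2 / 24 * M"
  proof (rule midpoint_le_integral_mean[OF \<open>a < b\<close> f f' _ int])
    show "- M \<le> f'' x" if "x \<in> {a<..<b}" for x
      using M[OF that] by linarith
  qed
  \<comment> \<open>The same estimate for \<open>- f\<close> bounds the difference with opposite
    sign, so the two together bound the absolute value.\<close>
  moreover have "- f ((a + b) / 2) - 1 / (b - a) * integral {a..b} (\<lambda>x. - f x)
      \<le> (b - a)\<^sup>2 / 24 * M"
  proof (rule midpoint_le_integral_mean[OF \<open>a < b\<close> DERIV_minus[OF f] DERIV_minus[OF f']])
    show "- M \<le> - f'' x" if "x \<in> {a<..<b}" for x
      using M[OF that] by linarith
    show "(\<lambda>x. - f x) integrable_on {a..b}"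
      using int by (rule integrable_neg)
  qed
  ultimately show ?thesis
    unfolding M_def[symmetric] integral_neg mult_minus_right by linarith
qed

end
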